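(* Let $a$ and $k$ be integers. If $D = a + k + 1 \geq 1$, then $$[n + k : an] = \frac{a^D}{(D - 1)! \left( e^a - \sum_{s = 0}^{D - 1} \frac{a^s}{s!} \right)},$$ provided that the convergents of the continued fraction are well-defined.
   Context: Given two sequences $a(n)$ and $b(n)$ and an integer $m \geq 1$, the $m$th convergent of their general continued fraction is defined by $[a(n) : b(n)]_1 = a(1)$ and $$[a(n) : b(n)]_{m+1} = a(1) + \frac{b(1)}{[a(n+1) : b(n+1)]_m}, \quad m \geq 1,$$ whenever these expressions are well-defined; here $[a(n+1) : b(n+1)]_m$ is the $m$th convergent for the shifted sequences $n \mapsto a(n+1)$ and $n \mapsto b(n+1)$. If all convergents are well-defined and $\lim_{m\to\infty} [a(n):b(n)]_m$ exists, then the general continued fraction $[a(n) : b(n)]$ is defined as $$[a(n) : b(n)] = \lim_{m \to \infty} [a(n):b(n)]_m = a(1) + \cfrac{b(1)}{a(2) + \cfrac{b(2)}{a(3) + \cdots}}.$$ In this notation $n$ is always the sequence variable and other letters are parameters. Thus $[n + k : an]$ is the general continued fraction whose two sequences are $n \mapsto n + k$ (in the role of $a(n)$) and $n \mapsto an$ (in the role of $b(n)$), where $a$ and $k$ are fixed integers.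
   Formalization: The formal statement assumes a ≠ 0; for a = 0 the right-hand side is 0/0 (since e^0 minus the sum is 0 and 0^D = 0), so the formula has no meaning there. *)

theory Defs
  imports Complex_Main
begin

text \<open>
  Sequences are indexed from 1: the values at 0 of the functions \<open>a, b :: nat \<Rightarrow> real\<close>
  are never used, and convergents are numbered by \<open>m \<ge> 1\<close>.  The equation for \<open>m = 0\<close>
  below is a dummy that only makes the function total; note also that, by the convention
  \<open>x / 0 = 0\<close>, a value \<open>gcf_convergent a b m\<close> is meaningful only together with
  \<open>gcf_convergent_defined a b m\<close>.
\<close>

fun gcf_convergent :: "(nat \<Rightarrow> real) \<Rightarrow> (nat \<Rightarrow> real) \<Rightarrow> nat \<Rightarrow> real" where
  "gcf_convergent a b 0 = undefined"
| "gcf_convergent a b (Suc 0) = a 1"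
| "gcf_convergent a b (Suc (Suc m)) =
     a 1 + b 1 / gcf_convergent (\<lambda>n. a (n + 1)) (\<lambda>n. b (n + 1)) (Suc m)"

fun gcf_convergent_defined :: "(nat \<Rightarrow> real) \<Rightarrow> (nat \<Rightarrow> real) \<Rightarrow> nat \<Rightarrow> bool" where
  "gcf_convergent_defined a b 0 \<longleftrightarrow> False"
| "gcf_convergent_defined a b (Suc 0) \<longleftrightarrow> True"
| "gcf_convergent_defined a b (Suc (Suc m)) \<longleftrightarrow>
     gcf_convergent_defined (\<lambda>n. a (n + 1)) (\<lambda>n. b (n + 1)) (Suc m) \<and>
     gcf_convergent (\<lambda>n. a (n + 1)) (\<lambda>n. b (n + 1)) (Suc m) \<noteq> 0"

definition gcf_well_defined :: "(nat \<Rightarrow> real) \<Rightarrow> (nat \<Rightarrow> real) \<Rightarrow> bool" where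
  "gcf_well_defined a b \<longleftrightarrow> (\<forall>m\<ge>1. gcf_convergent_defined a b m)"

definition gcf_exists :: "(nat \<Rightarrow> real) \<Rightarrow> (nat \<Rightarrow> real) \<Rightarrow> bool" where
  "gcf_exists a b \<longleftrightarrow> gcf_well_defined a b \<and> convergent (gcf_convergent a b)"

text \<open>The value is meaningful only when \<open>gcf_exists a b\<close> holds.\<close>

definition gcf :: "(nat \<Rightarrow> real) \<Rightarrow> (nat \<Rightarrow> real) \<Rightarrow> real" where
  "gcf a b = lim (gcf_convergent a b)"

end

theory Submission
  imports Defs "HOL-Analysis.Analysis"
begin

text \<open>
  Numerators and denominators of the convergents satisfy the three-term recurrence
  \<open>y(m) = (m + k) y(m - 1) + a (m - 1) y(m - 2)\<close>.  Integrating the derivative of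
  \<open>t^(m - 1) (1 - t)^D e^(a t)\<close> over \<open>[0, 1]\<close> shows that
  \<open>f(m) = (-a)^m p(m)\<close> with \<open>p(m) = \<integral> t^m (1 - t)^(D - 1) e^(a t) dt\<close> is a solution as well.
  It grows only exponentially, while the Casoratian of \<open>f\<close> and the denominators grows
  factorially; so \<open>f\<close> is negligible against the denominators, and, as in Pincherle's theorem, the
  continued fraction equals \<open>1 + k - f(1) / f(0) = 1 / p(0)\<close>, where \<open>p(0)\<close> is the integral form
  of the remainder of the exponential series.
\<close>

section \<open>The three-term recurrence\<close>

text \<open>The values at 0 encode the formal convergent 1/0, so that index m belongs to the m-th
  convergent.\<close>

fun cnum :: "(nat \<Rightarrow> real) \<Rightarrow> (nat \<Rightarrow> real) \<Rightarrow> nat \<Rightarrow> real" where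
  "cnum a b 0 = 1"
| "cnum a b (Suc 0) = a 1"
| "cnum a b (Suc (Suc m)) = a (m + 2) * cnum a b (Suc m) + b (m + 1) * cnum a b m"

fun cden :: "(nat \<Rightarrow> real) \<Rightarrow> (nat \<Rightarrow> real) \<Rightarrow> nat \<Rightarrow> real" where
  "cden a b 0 = 0"
| "cden a b (Suc 0) = 1"
| "cden a b (Suc (Suc m)) = a (m + 2) * cden a b (Suc m) + b (m + 1) * cden a b m"

text \<open>\<open>gcf_convergent\<close> peels off the first term, while the recurrence appends a
  last one; this lemma and the next reconcile the two.\<close>

lemma cden_shift: "cden a b (Suc m) = cnum (\<lambda>n. a (n + 1)) (\<lambda>n. b (n + 1)) m"
  by (induction m rule: induct_nat_012) (auto simp: numeral_eq_Suc)

lemma cnum_shift: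
  "cnum a b (Suc m) = a 1 * cnum (\<lambda>n. a (n + 1)) (\<lambda>n. b (n + 1)) m
     + b 1 * cden (\<lambda>n. a (n + 1)) (\<lambda>n. b (n + 1)) m"
  by (induction m rule: induct_nat_012) (auto simp: numeral_eq_Suc algebra_simps)

text \<open>By \<open>cden_shift\<close> the denominator is the numerator of the tail, which is
  nonzero because the tail convergent is.\<close>

lemma gcf_convergent_eq_cnum_div_cden:
  assumes "gcf_convergent_defined a b (Suc m)"
  shows "cden a b (Suc m) \<noteq> 0 \<and> gcf_convergent a b (Suc m) = cnum a b (Suc m) / cden a b (Suc m)"
  using assms
proof (induction m arbitrary: a b)
  case 0
  then show ?case by simp
next
  case (Suc m)
  let ?a = "\<lambda>n. a (n + 1)" and ?b = "\<lambda>n. b (n + 1)"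
  have IH: "cden ?a ?b (Suc m) \<noteq> 0"
      "gcf_convergent ?a ?b (Suc m) = cnum ?a ?b (Suc m) / cden ?a ?b (Suc m)"
    and nz: "gcf_convergent ?a ?b (Suc m) \<noteq> 0"
    using Suc.IH[of ?a ?b] Suc.prems by auto
  have num_nz: "cnum ?a ?b (Suc m) \<noteq> 0"
    using IH nz by auto
  have "gcf_convergent a b (Suc (Suc m))
      = a 1 + b 1 / (cnum ?a ?b (Suc m) / cden ?a ?b (Suc m))"
    using IH(2) by simp
  also have "\<dots> = cnum a b (Suc (Suc m)) / cden a b (Suc (Suc m))"
    unfolding cden_shift[of a b "Suc m"] cnum_shift[of a b "Suc m"]
    using num_nz by (simp add: field_simps del: cnum.simps cden.simps)
  finally show ?case
    using num_nz cden_shift[of a b "Suc m"] by simp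
qed

text \<open>Both sides solve the recurrence and agree at 0 and 1.\<close>

lemma recurrence_solution_decomposition:
  assumes "\<And>m. f (Suc (Suc m)) = a (m + 2) * f (Suc m) + b (m + 1) * f m"
  shows "f m = f 0 * cnum a b m + (f 1 - f 0 * a 1) * cden a b m"
proof (induction m rule: induct_nat_012)
  case (ge2 m)
  show ?case
    unfolding assms ge2 cnum.simps cden.simps by (simp add: algebra_simps)
qed auto

lemma casoratian:
  assumes "\<And>m. f (Suc (Suc m)) = a (m + 2) * f (Suc m) + b (m + 1) * f m"
  shows "f (Suc m) * cden a b m - f m * cden a b (Suc m) = - f 0 * (\<Prod>i<m. - b (i + 1))"
proof (induction m)
  case 0
  then show ?case by simp
next
  case (Suc m)
  have "f (Suc (Suc m)) * cden a b (Suc m) - f (Suc m) * cden a b (Suc (Suc m))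
      = - b (m + 1) * (f (Suc m) * cden a b m - f m * cden a b (Suc m))"
    by (simp add: assms algebra_simps)
  then show ?case
    by (simp add: Suc.IH)
qed

text \<open>Dividing the decomposition of \<open>f\<close> by \<open>f 0 * cden a b m\<close>
  expresses the convergent as the limit plus a vanishing error.\<close>

lemma gcf_convergent_tendsto:
  assumes wd: "gcf_well_defined a b"
    and rec: "\<And>m. f (Suc (Suc m)) = a (m + 2) * f (Suc m) + b (m + 1) * f m"
    and nz: "f 0 \<noteq> 0"
    and negligible: "(\<lambda>m. f (Suc m) / cden a b (Suc m)) \<longlonglongrightarrow> 0"
  shows "gcf_convergent a b \<longlonglongrightarrow> a 1 - f 1 / f 0"
proof -
  have eq: "gcf_convergent a b (Suc m)
      = (a 1 - f 1 / f 0) + (f (Suc m) / cden a b (Suc m)) / f 0" for m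
  proof -
    have "gcf_convergent_defined a b (Suc m)"
      using wd by (simp add: gcf_well_defined_def)
    from gcf_convergent_eq_cnum_div_cden[OF this]
    have B: "cden a b (Suc m) \<noteq> 0"
      and c: "gcf_convergent a b (Suc m) = cnum a b (Suc m) / cden a b (Suc m)" by auto
    have "f (Suc m) = f 0 * cnum a b (Suc m) + (f 1 - f 0 * a 1) * cden a b (Suc m)"
      by (rule recurrence_solution_decomposition[of f a b, OF rec])
    then show ?thesis
      unfolding c using B nz by (simp add: field_simps del: cnum.simps cden.simps)
  qed
  \<comment> \<open>Shifting the index avoids the dummy value at 0.\<close>
  have "(\<lambda>m. gcf_convergent a b (Suc m)) \<longlonglongrightarrow> (a 1 - f 1 / f 0) + 0 / f 0"
    unfolding eq by (intro tendsto_intros negligible nz)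
  then show ?thesis
    by (simp add: filterlim_sequentially_Suc)
qed

section \<open>The integrals of the minimal solution\<close>

text \<open>This is Beta(m+1, d+1) times Kummer's function M(m+1, m+d+2, a).\<close>

definition expbeta :: "real \<Rightarrow> nat \<Rightarrow> nat \<Rightarrow> real" where
  "expbeta a d m = integral {0..1} (\<lambda>t. t ^ m * (1 - t) ^ d * exp (a * t))"

lemma expbeta_integrable: "(\<lambda>t::real. t ^ m * (1 - t) ^ d * exp (a * t)) integrable_on {0..1}"
  by (intro integrable_continuous_real continuous_intros)

lemma expbeta_has_integral:
  "((\<lambda>t::real. t ^ m * (1 - t) ^ d * exp (a * t)) has_integral expbeta a d m) {0..1}"
  unfolding expbeta_def by (rule integrable_integral[OF expbeta_integrable])

lemma expbeta_pos: "expbeta a d m > 0"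
proof -
  have "expbeta a d m \<noteq> 0"
  proof
    assume "expbeta a d m = 0"
    then have "((\<lambda>t::real. t ^ m * (1 - t) ^ d * exp (a * t)) has_integral 0) (cbox 0 1)"
      using expbeta_has_integral[of m d a] by simp
    \<comment> \<open>A nonnegative continuous function with integral 0 vanishes on the whole
      interval, but here every factor is positive at 1/2.\<close>
    then have "(1/2::real) ^ m * (1 - 1/2) ^ d * exp (a * (1/2)) = 0"
      by (rule has_integral_0_cbox_imp_0[rotated 2]) (auto intro!: continuous_intros)
    then show False by simp
  qed
  moreover have "expbeta a d m \<ge> 0"
    unfolding expbeta_def by (intro integral_nonneg expbeta_integrable) auto
  ultimately show ?thesis by simp
qed

lemma expbeta_antimono: "m \<le> n \<Longrightarrow> expbeta a d n \<le> expbeta a d m"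
  unfolding expbeta_def
  by (intro integral_le expbeta_integrable)
     (auto intro!: mult_right_mono power_decreasing)

lemma expbeta_ftc:
  "(real m + 1) * expbeta a d m - (real m + 2 + real d - a) * expbeta a d (Suc m)
     - a * expbeta a d (Suc (Suc m)) = 0"
proof -
  let ?F = "\<lambda>t::real. t ^ Suc m * (1 - t) ^ Suc d * exp (a * t)"
  let ?G = "\<lambda>n t::real. t ^ n * (1 - t) ^ d * exp (a * t)"
  let ?f = "\<lambda>t. (real m + 1) * ?G m t - (real m + 2 + real d - a) * ?G (Suc m) t
     - a * ?G (Suc (Suc m)) t"
  have 1: "(?f has_integral (?F 1 - ?F 0)) {0..1}"
  proof (rule fundamental_theorem_of_calculus)
    fix t :: real
    have "(?F has_real_derivative ?f t) (at t within {0..1})"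
      by (rule derivative_eq_intros refl | simp)+ (simp add: algebra_simps)
    then show "(?F has_vector_derivative ?f t) (at t within {0..1})"
      by (simp add: has_real_derivative_iff_has_vector_derivative)
  qed simp
  have 2: "(?f has_integral ((real m + 1) * expbeta a d m
      - (real m + 2 + real d - a) * expbeta a d (Suc m) - a * expbeta a d (Suc (Suc m)))) {0..1}"
    by (intro has_integral_diff has_integral_mult_right expbeta_has_integral)
  show ?thesis
    using has_integral_unique[OF 1 2] by simp
qed

text \<open>Boundary case of \<open>expbeta_ftc\<close>: without a factor t in the antiderivative,
  the endpoint 0 contributes 1.\<close>

lemma expbeta_ftc_0: "(1 + real d - a) * expbeta a d 0 + a * expbeta a d 1 = 1"
proof -
  let ?F = "\<lambda>t::real. - ((1 - t) ^ Suc d * exp (a * t))"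
  let ?G = "\<lambda>n t::real. t ^ n * (1 - t) ^ d * exp (a * t)"
  let ?f = "\<lambda>t. (1 + real d - a) * ?G 0 t + a * ?G 1 t"
  have 1: "(?f has_integral (?F 1 - ?F 0)) {0..1}"
  proof (rule fundamental_theorem_of_calculus)
    fix t :: real
    have "(?F has_real_derivative ?f t) (at t within {0..1})"
      by (rule derivative_eq_intros refl | simp)+ (simp add: algebra_simps)
    then show "(?F has_vector_derivative ?f t) (at t within {0..1})"
      by (simp add: has_real_derivative_iff_has_vector_derivative)
  qed simp
  have 2: "(?f has_integral ((1 + real d - a) * expbeta a d 0 + a * expbeta a d 1)) {0..1}"
    by (intro has_integral_add has_integral_mult_right expbeta_has_integral)
  show ?thesis
    using has_integral_unique[OF 1 2] by simp
qed

text \<open>Split (1-t)^(d+1) = (1-t)^d - t (1-t)^d, then eliminate \<open>expbeta a d 1\<close> by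
  \<open>expbeta_ftc_0\<close>.\<close>

lemma expbeta_Suc_exponent: "a * expbeta a (Suc d) 0 = (real d + 1) * expbeta a d 0 - 1"
proof -
  have "((\<lambda>t. t ^ 0 * (1 - t) ^ d * exp (a * t) - t ^ 1 * (1 - t) ^ d * exp (a * t))
      has_integral (expbeta a d 0 - expbeta a d 1)) {0..1}"
    by (intro has_integral_diff expbeta_has_integral)
  then have "((\<lambda>t. t ^ 0 * (1 - t) ^ Suc d * exp (a * t))
      has_integral (expbeta a d 0 - expbeta a d 1)) {0..1}"
    by (simp add: algebra_simps)
  then have "expbeta a (Suc d) 0 = expbeta a d 0 - expbeta a d 1"
    using has_integral_unique expbeta_has_integral by blast
  then have "a * expbeta a (Suc d) 0 = a * expbeta a d 0 - a * expbeta a d 1"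
    by (simp add: right_diff_distrib)
  then show ?thesis
    using expbeta_ftc_0[of d a] by (simp add: algebra_simps)
qed

lemma expbeta_eq_exp_remainder:
  "a ^ Suc d * expbeta a d 0 = fact d * (exp a - (\<Sum>s = 0..d. a ^ s / fact s))"
proof (induction d)
  case 0
  have "((\<lambda>t. a * (t ^ 0 * (1 - t) ^ 0 * exp (a * t))) has_integral (exp (a * 1) - exp (a * 0))) {0..1}"
  proof (rule fundamental_theorem_of_calculus)
    fix t :: real
    show "((\<lambda>t. exp (a * t)) has_vector_derivative a * (t ^ 0 * (1 - t) ^ 0 * exp (a * t)))
        (at t within {0..1})"
      unfolding has_real_derivative_iff_has_vector_derivative[symmetric]
      by (rule derivative_eq_intros refl | simp)+
  qed simp
  moreover have "((\<lambda>t. a * (t ^ 0 * (1 - t) ^ 0 * exp (a * t))) has_integral (a * expbeta a 0 0)) {0..1}"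
    by (intro has_integral_mult_right expbeta_has_integral)
  ultimately have "a * expbeta a 0 0 = exp (a * 1) - exp (a * 0)"
    using has_integral_unique by blast
  then show ?case by simp
next
  case (Suc d)
  have "a ^ Suc (Suc d) * expbeta a (Suc d) 0 = a ^ Suc d * (a * expbeta a (Suc d) 0)"
    by simp
  also have "\<dots> = (real d + 1) * (a ^ Suc d * expbeta a d 0) - a ^ Suc d"
    by (simp add: expbeta_Suc_exponent algebra_simps)
  also have "\<dots> = fact (Suc d) * (exp a - (\<Sum>s = 0..Suc d. a ^ s / fact s))"
  proof -
    \<comment> \<open>The subtracted power is (d+1)! times the next Taylor term, so it joins the
      sum.\<close>
    have "a ^ Suc d = fact (Suc d) * (a ^ Suc d / fact (Suc d))"
      by (simp del: fact_Suc)
    moreover have "fact (Suc d) = (real d + 1) * fact d"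
      by simp
    ultimately show ?thesis
      unfolding Suc.IH by (simp add: right_diff_distrib distrib_left del: fact_Suc power_Suc)
  qed
  finally show ?case .
qed

section \<open>Negligibility of the minimal solution\<close>

text \<open>Once m > 2c the factor is at most 1/2, which keeps \<open>h\<close> bounded; the
  deviation from 1 is then O(1/m).\<close>

lemma tendsto_one_of_perturbed_recurrence:
  fixes h :: "nat \<Rightarrow> real"
  assumes step: "\<And>m. \<bar>h (Suc m) - 1\<bar> \<le> c / real (Suc m) * \<bar>h m\<bar>" and "c \<ge> 0"
  shows "h \<longlonglongrightarrow> 1"
proof -
  obtain N :: nat where N: "real N > 2 * c"
    using reals_Archimedean2 by blast
  \<comment> \<open>K \<ge> 2 is what gives 1 + K/2 \<le> K.\<close>
  define K where "K = max 2 \<bar>h N\<bar>"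
  have bound: "\<bar>h m\<bar> \<le> K" if "m \<ge> N" for m
    using that
  proof (induction m rule: dec_induct)
    case base
    then show ?case by (simp add: K_def)
  next
    case (step m)
    have "c / real (Suc m) \<le> 1 / 2"
      using N step.hyps by (simp add: field_simps)
    then have "c / real (Suc m) * \<bar>h m\<bar> \<le> 1 / 2 * K"
      using step.IH by (intro mult_mono) auto
    then have "\<bar>h (Suc m)\<bar> \<le> 1 + K / 2"
      using assms(1)[of m] by linarith
    also have "\<dots> \<le> K"
      by (simp add: K_def)
    finally show ?case .
  qed
  have "(\<lambda>m. h (Suc m) - 1) \<longlonglongrightarrow> 0"
  proof (rule Lim_null_comparison)
    show "\<forall>\<^sub>F m in sequentially. norm (h (Suc m) - 1) \<le> (c * K) / real (Suc m)"
    proof (rule eventually_sequentiallyI[of N])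
      fix m assume "N \<le> m"
      then have "c / real (Suc m) * \<bar>h m\<bar> \<le> c / real (Suc m) * K"
        using bound \<open>c \<ge> 0\<close> by (intro mult_left_mono) auto
      then show "norm (h (Suc m) - 1) \<le> (c * K) / real (Suc m)"
        using step[of m] by simp
    qed
    show "(\<lambda>m. (c * K) / real (Suc m)) \<longlonglongrightarrow> 0"
      using LIMSEQ_Suc[OF lim_const_over_n] .
  qed
  then have "(\<lambda>m. h (Suc m)) \<longlonglongrightarrow> 1"
    by (simp add: LIM_zero_iff)
  then show ?thesis
    by (simp add: filterlim_sequentially_Suc)
qed

lemma prod_neg_mult: "(\<Prod>i<m. - (c * real (i + 1))) = (- c) ^ m * fact m"
  by (induction m) (auto simp: algebra_simps)

text \<open>With W the Casoratian, f(m+1)/B(m+1) is the quotient of -f(m+1) f(m)/W(m) by h(m). The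
  former tends to 0, as W has the factor m! and p is bounded; h tends to 1.\<close>

lemma minimal_solution_negligible:
  fixes c :: real and p :: "nat \<Rightarrow> real" and a b :: "nat \<Rightarrow> real"
  defines "f \<equiv> \<lambda>m. (- c) ^ m * p m"
  assumes "c \<noteq> 0" and b: "b = (\<lambda>n. c * real n)"
    and pos: "\<And>m. p m > 0" and anti: "\<And>m n. m \<le> n \<Longrightarrow> p n \<le> p m"
    and rec: "\<And>m. f (Suc (Suc m)) = a (m + 2) * f (Suc m) + b (m + 1) * f m"
  shows "(\<lambda>m. f (Suc m) / cden a b (Suc m)) \<longlonglongrightarrow> 0"
proof -
  define B where "B = cden a b"
  define W where "W = (\<lambda>m. - p 0 * ((- c) ^ m * fact m))"
  have W: "f (Suc m) * B m - f m * B (Suc m) = W m" for m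
    using casoratian[of f a b m, OF rec] prod_neg_mult[of c m]
    by (simp add: B_def W_def b f_def)
  have W_nz: "W m \<noteq> 0" for m
    using pos[of 0] \<open>c \<noteq> 0\<close> by (simp add: W_def)
  have W_Suc: "W (Suc m) = - c * real (Suc m) * W m" for m
    by (simp add: W_def algebra_simps)
  have f_nz: "f m \<noteq> 0" for m
    using pos[of m] \<open>c \<noteq> 0\<close> by (simp add: f_def)
  have f_Suc2: "f (Suc (Suc m)) = c\<^sup>2 * (p (Suc (Suc m)) / p m) * f m" for m
    using pos[of m] by (simp add: f_def power2_eq_square)
  \<comment> \<open>If \<open>g = B / f\<close>, then \<open>h m = g (m + 1) / (g (m + 1) - g m)\<close>.\<close>
  define h where "h = (\<lambda>m. - B (Suc m) * f m / W m)"
  have "\<bar>h (Suc m) - 1\<bar> \<le> \<bar>c\<bar> / real (Suc m) * \<bar>h m\<bar>" for m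
  proof -
    \<comment> \<open>The Casoratian identity at m+1, divided by W(m+1).\<close>
    have "h (Suc m) - 1 = - f (Suc (Suc m)) * B (Suc m) / W (Suc m)"
      using W[of "Suc m"] W_nz[of "Suc m"] by (simp add: h_def field_simps)
    \<comment> \<open>Going back to f(m) and W(m) restores h(m); the factor m+1 gained by W yields
      the decay, and monotonicity of p bounds the ratio by 1.\<close>
    also have "\<dots> = - (c / real (Suc m)) * (p (Suc (Suc m)) / p m) * h m"
      unfolding h_def f_Suc2 W_Suc using \<open>c \<noteq> 0\<close> W_nz[of m] pos[of m]
      by (simp add: field_simps power2_eq_square del: of_nat_Suc)
    finally have "\<bar>h (Suc m) - 1\<bar> = \<bar>c\<bar> / real (Suc m) * (p (Suc (Suc m)) / p m) * \<bar>h m\<bar>"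
      using pos[of m] pos[of "Suc (Suc m)"] by (simp add: abs_mult)
    also have "\<dots> \<le> \<bar>c\<bar> / real (Suc m) * 1 * \<bar>h m\<bar>"
      using pos[of m] pos[of "Suc (Suc m)"] anti[of m "Suc (Suc m)"]
      by (intro mult_right_mono mult_mono) auto
    finally show ?thesis by simp
  qed
  then have h: "h \<longlonglongrightarrow> 1"
    by (rule tendsto_one_of_perturbed_recurrence) simp
  have small: "(\<lambda>m. - f (Suc m) * f m / W m) \<longlonglongrightarrow> 0"
  proof (rule Lim_null_comparison)
    show "\<forall>\<^sub>F m in sequentially. norm (- f (Suc m) * f m / W m)
        \<le> \<bar>c\<bar> * p 0 * (\<bar>c\<bar> ^ m / fact m)"
    proof (rule always_eventually, rule allI)
      fix m
      have "norm (- f (Suc m) * f m / W m) = \<bar>c\<bar> * (\<bar>c\<bar> ^ m / fact m) * (p (Suc m) * (p m / p 0))"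
        using pos[of m] pos[of "Suc m"] pos[of 0] \<open>c \<noteq> 0\<close>
        by (simp add: f_def W_def abs_mult power_abs field_simps)
      also have "\<dots> \<le> \<bar>c\<bar> * (\<bar>c\<bar> ^ m / fact m) * (p 0 * 1)"
        using pos[of m] pos[of "Suc m"] pos[of 0] anti[of 0 m] anti[of 0 "Suc m"]
        by (intro mult_left_mono mult_mono) auto
      finally show "norm (- f (Suc m) * f m / W m) \<le> \<bar>c\<bar> * p 0 * (\<bar>c\<bar> ^ m / fact m)"
        by (simp add: mult_ac)
    qed
    show "(\<lambda>m. \<bar>c\<bar> * p 0 * (\<bar>c\<bar> ^ m / fact m)) \<longlonglongrightarrow> 0"
      using summable_LIMSEQ_zero[OF summable_exp[of "\<bar>c\<bar>"]]
      by (intro tendsto_mult_right_zero) (simp add: field_simps)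
  qed
  have "(\<lambda>m. (- f (Suc m) * f m / W m) / h m) \<longlonglongrightarrow> 0 / 1"
    by (intro tendsto_divide small h) simp
  \<comment> \<open>If B(m+1) = 0 then h(m) = 0, and both sides are 0 by x / 0 = 0.\<close>
  moreover have "(- f (Suc m) * f m / W m) / h m = f (Suc m) / B (Suc m)" for m
    using f_nz[of m] W_nz[of m] by (simp add: h_def)
  ultimately show ?thesis
    by (simp add: B_def)
qed

text \<open>The case a = 0 is excluded because the right-hand side becomes 0/0, while the continued
  fraction has the value k + 1.\<close>

theorem theorem1:
  fixes a k D :: int
  assumes "D = a + k + 1" and "D \<ge> 1"
    and "a \<noteq> 0"
    and "gcf_well_defined (\<lambda>n. of_int (int n + k)) (\<lambda>n. of_int (a * int n))"
  shows "gcf_exists (\<lambda>n. of_int (int n + k)) (\<lambda>n. of_int (a * int n)) \<and>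
    gcf (\<lambda>n. of_int (int n + k)) (\<lambda>n. of_int (a * int n)) =
      real_of_int a ^ nat D /
        (fact (nat (D - 1)) *
          (exp (real_of_int a) - (\<Sum>s = 0..nat (D - 1). real_of_int a ^ s / fact s)))"
proof -
  let ?A = "\<lambda>n. real_of_int (int n + k)" and ?B = "\<lambda>n. real_of_int (a * int n)"
  define c where "c = real_of_int a"
  define d where "d = nat (D - 1)"
  define p where "p = expbeta c d"
  define f where "f = (\<lambda>m. (- c) ^ m * p m)"
  have "c \<noteq> 0"
    using assms(3) by (simp add: c_def)
  have k: "real_of_int k = real d - c"
    using assms(1,2) by (simp add: c_def d_def)
  have rec: "f (Suc (Suc m)) = ?A (m + 2) * f (Suc m) + ?B (m + 1) * f m" for m
  proof -
    have "c * p (Suc (Suc m)) = (real m + 1) * p m - (real m + 2 + real d - c) * p (Suc m)"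
      using expbeta_ftc[of m c d] by (simp add: p_def)
    \<comment> \<open>The scaling by powers of -c turns the leading coefficient c of p(m+2) into
      1.\<close>
    then have "(- c) ^ Suc m * (- (c * p (Suc (Suc m))))
        = (- c) ^ Suc m * ((real m + 2 + real d - c) * p (Suc m) - (real m + 1) * p m)"
      by simp
    then show ?thesis
      unfolding f_def by (simp add: k c_def[symmetric] algebra_simps)
  qed
  have p0: "p 0 > 0"
    by (simp add: p_def expbeta_pos)
  have "(\<lambda>m. f (Suc m) / cden ?A ?B (Suc m)) \<longlonglongrightarrow> 0"
    using minimal_solution_negligible[of c ?B p ?A] rec \<open>c \<noteq> 0\<close>
    by (simp add: f_def p_def c_def expbeta_pos expbeta_antimono)
  then have lim: "gcf_convergent ?A ?B \<longlonglongrightarrow> ?A 1 - f 1 / f 0"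
    using gcf_convergent_tendsto[where f = f, OF assms(4) rec] p0 by (simp add: f_def)
  \<comment> \<open>Here f(1)/f(0) = -c p(1)/p(0), so the left side is \<open>expbeta_ftc_0\<close>
    divided by p(0).\<close>
  have "?A 1 - f 1 / f 0 = 1 / p 0"
    using expbeta_ftc_0[of d c] p0 by (simp add: f_def k p_def[symmetric] field_simps)
  \<comment> \<open>Expanding by this power makes the denominator the Taylor remainder.\<close>
  also have "\<dots> = c ^ Suc d / (c ^ Suc d * p 0)"
    using \<open>c \<noteq> 0\<close> by simp
  also have "\<dots> = c ^ Suc d / (fact d * (exp c - (\<Sum>s = 0..d. c ^ s / fact s)))"
    unfolding p_def expbeta_eq_exp_remainder ..
  also have "Suc d = nat D"
    using assms(2) by (simp add: d_def)
  finally have "?A 1 - f 1 / f 0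
      = c ^ nat D / (fact d * (exp c - (\<Sum>s = 0..d. c ^ s / fact s)))" .
  with lim show ?thesis
    using assms(4) unfolding gcf_exists_def gcf_def c_def d_def
    by (auto simp: convergent_def limI)
qed

end
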